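(* Let $A\subset\mathbb{Z}$ be a finite non-empty set, let $K$ be a real number, let $k\geq 1$, and let $\lambda_1,\dots,\lambda_k$ be integers. If either $|A+A|\leq K|A|$ or $|A-A|\leq K|A|$, then $$|\lambda_1\cdot A+\dots+\lambda_k\cdot A|\leq K^p|A|,\qquad\text{where}\qquad p=7+12\sum_{i=1}^k\log_2(1+|\lambda_i|).$$
   Context: For sets $A,B\subset\mathbb{Z}$, $A+B=\{a+b: a\in A,\ b\in B\}$ and $A-B=\{a-b: a\in A,\ b\in B\}$ (and similarly for several summands). For an integer $\lambda$, the dilate of $A$ by $\lambda$ is $\lambda\cdot A=\{\lambda a: a\in A\}$. $|A|$ denotes the cardinality of $A$. *)

theory Defs
  imports Complex_Main "HOL-Library.Set_Algebras"
begin

(* A - B denotes set-theoretic difference on sets, so the difference set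
   needs a name of its own. *)

definition difference_set :: "int set \<Rightarrow> int set \<Rightarrow> int set" where
  "difference_set A B = {a - b | a b. a \<in> A \<and> b \<in> B}"

end

theory Submission
  imports Defs
begin

text \<open>
  Expand the coefficients in signed binary, so that \<open>\<lambda>\<^sub>i = \<epsilon>\<^sub>i + 2 \<mu>\<^sub>i\<close> with
  \<open>\<epsilon>\<^sub>i \<in> {-1, 0, 1}\<close>. If \<open>\<Sum> \<mu>\<^sub>i A\<close> lies in a union of \<open>N\<close> translates of \<open>A - A\<close>, then
  \<open>\<Sum> \<lambda>\<^sub>i A\<close> lies in \<open>N\<close> translates of \<open>E + 2A - 2A\<close>, where \<open>E = \<Sum> \<epsilon>\<^sub>i A\<close> and \<open>2A\<close> is a dilate.
  Since \<open>2A \<subseteq> A + A\<close>, the Pluennecke-Ruzsa inequality and Ruzsa's covering lemma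
  cover \<open>E + 2A - 2A\<close> by \<open>K ^ (\<Sum> \<bar>\<epsilon>\<^sub>i\<bar> + 5)\<close> translates of \<open>A - A\<close>. Because
  \<open>\<bar>\<epsilon>\<bar> + log 2 (1 + \<bar>\<mu>\<bar>) \<le> log 2 (1 + \<bar>\<lambda>\<bar>)\<close>, the digits cost at most
  \<open>L = \<Sum> log 2 (1 + \<bar>\<lambda>\<^sub>i\<bar>)\<close> in total, and there are at most \<open>1 + L\<close> binary places.
\<close>

section \<open>The Pluennecke-Ruzsa inequality\<close>

text \<open>
  Petridis's argument: when \<open>c\<close> is added to \<open>C\<close>, all of \<open>Z + B + c\<close> is already present in
  \<open>X + B + C\<close>, and the minimality of the ratio bounds \<open>card (Z + B)\<close> from below.
\<close>

lemma card_plus_le_of_minimal_ratio: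
  fixes X B C :: "'a::ab_group_add set" and r :: real
  assumes "finite X" "finite B" "finite C" "0 \<le> r"
    and min: "\<And>Z. Z \<subseteq> X \<Longrightarrow> r * card Z \<le> card (Z + B)"
    and eq: "card (X + B) = r * card X"
  shows "card (X + B + C) \<le> r * card (X + C)"
  using \<open>finite C\<close>
proof (induction C)
  case empty
  then show ?case by simp
next
  case (insert c C)
  define Z where "Z = {x \<in> X. (\<lambda>b. x + c + b) ` B \<subseteq> X + B + C}"
  have ZX: "Z \<subseteq> X" by (auto simp: Z_def)
  have finZ: "finite Z" using ZX \<open>finite X\<close> finite_subset by blast
  have fin: "finite (X + B)" "finite (X + B + C)" "finite (X + C)" "finite (Z + B)"
      "finite (X + insert c C)"
    using assms insert finZ by (simp_all add: finite_set_plus)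
  have ZB: "Z + B \<subseteq> X + B" using ZX by (intro set_plus_mono2 order.refl)
  have "X + B + insert c C \<subseteq> (X + B + C) \<union> (\<lambda>y. y + c) ` ((X + B) - (Z + B))"
  proof
    fix u assume "u \<in> X + B + insert c C"
    then obtain x b d where u: "u = (x + b) + d" and xb: "x \<in> X" "b \<in> B" and d: "d \<in> insert c C"
      by (auto elim!: set_plus_elim)
    show "u \<in> (X + B + C) \<union> (\<lambda>y. y + c) ` ((X + B) - (Z + B))"
    proof (cases "d \<in> C \<or> x + b \<in> Z + B")
      case False
      then show ?thesis using u xb d by (auto intro!: imageI)
    next
      case True
      then show ?thesis
      proof
        assume "d \<in> C"
        then show ?thesis using u xb by blast
      next
        assume "x + b \<in> Z + B"
        then obtain z b' where z: "z \<in> Z" "b' \<in> B" "x + b = z + b'"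
          by (auto elim!: set_plus_elim)
        then have "z + c + b' \<in> X + B + C" by (auto simp: Z_def)
        moreover have "z + c + b' = x + b + c" using z(3) by (simp add: algebra_simps)
        ultimately show ?thesis using u d \<open>x \<in> X\<close> \<open>b \<in> B\<close> by auto
      qed
    qed
  qed
  then have "card (X + B + insert c C)
      \<le> card ((X + B + C) \<union> (\<lambda>y. y + c) ` ((X + B) - (Z + B)))"
    using fin by (intro card_mono) auto
  also have "\<dots> \<le> card (X + B + C) + card ((X + B) - (Z + B))"
    using fin by (intro order.trans[OF card_Un_le] add_left_mono card_image_le) auto
  finally have "card (X + B + insert c C) + card (Z + B) \<le> card (X + B + C) + card (X + B)"
    using card_Diff_subset[OF fin(4) ZB] card_mono[OF fin(1) ZB] by linarith
  then have up: "real (card (X + B + insert c C)) \<le> r * card (X + C) + r * card X - r * card Z"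
    using insert.IH min[OF ZX] eq by linarith
  \<comment> \<open>If \<open>x + c = x' + c'\<close> with \<open>c'\<close> in \<open>C\<close>,
    then \<open>x + c + b = x' + b + c'\<close> is in \<open>X + B + C\<close> for every
    \<open>b\<close>, so \<open>x\<close> is in \<open>Z\<close>. Hence adding \<open>c\<close> to
    the points of \<open>X\<close> outside \<open>Z\<close> gives only new elements.\<close>
  have disj: "(X + C) \<inter> (\<lambda>x. x + c) ` (X - Z) = {}"
  proof -
    have "x \<in> Z" if "x \<in> X" "x + c \<in> X + C" for x
    proof -
      obtain x' c' where x': "x' \<in> X" "c' \<in> C" "x + c = x' + c'"
        using \<open>x + c \<in> X + C\<close> by (auto elim!: set_plus_elim)
      have "x + c + b \<in> X + B + C" if "b \<in> B" for b
      proof -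
        have "x + c + b = x' + b + c'" using x'(3) by (simp add: algebra_simps)
        also have "\<dots> \<in> X + B + C" using x' that by (intro set_plus_intro)
        finally show ?thesis .
      qed
      then show ?thesis using \<open>x \<in> X\<close> by (auto simp: Z_def)
    qed
    then show ?thesis by auto
  qed
  have "card (X + C) + card (X - Z) = card ((X + C) \<union> (\<lambda>x. x + c) ` (X - Z))"
    using disj fin \<open>finite X\<close> by (subst card_Un_disjoint) (auto simp: card_image inj_on_def)
  also have "\<dots> \<le> card (X + insert c C)"
    using fin set_plus_mono2[OF order.refl[of X] subset_insertI[of C c]]
    by (intro card_mono) auto
  finally have "card (X + C) + card X \<le> card (X + insert c C) + card Z"
    using card_Diff_subset[OF finZ ZX] card_mono[OF \<open>finite X\<close> ZX] by linarith
  then have "r * (real (card (X + C)) + card X) \<le> r * (real (card (X + insert c C)) + card Z)"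
    using \<open>0 \<le> r\<close> by (intro mult_left_mono) linarith+
  then show ?case using up by (simp add: algebra_simps)
qed

section \<open>From a minimal ratio to iterated sumsets\<close>

lemma finite_sumset_const: "finite B \<Longrightarrow> finite (\<Sum>i<n. B)" for n :: nat
  by (induction n) (simp_all add: finite_set_plus)

text \<open>A non-empty \<open>X\<close> minimizing \<open>card (X + B) / card X\<close> has ratio
  at most \<open>K\<close>, because \<open>A\<close> itself competes. Each further summand
  \<open>B\<close> then costs at most this ratio. The choice of \<open>X\<close> precedes
  \<open>n\<close>, so one \<open>X\<close> serves all sumsets of \<open>B\<close>.\<close>

lemma Pluennecke:
  fixes A B :: "'a::ab_group_add set" and K :: real
  assumes "finite A" "A \<noteq> {}" "finite B" "card (A + B) \<le> K * card A"
  obtains X where "X \<subseteq> A" "X \<noteq> {}" "\<And>n. card (X + (\<Sum>i<n. B)) \<le> K ^ n * card X"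
proof -
  define q where "q X = real (card (X + B)) / card X" for X
  \<comment> \<open>The empty set must be excluded: division by zero would give it ratio 0.\<close>
  have "finite (Pow A - {{}})" "Pow A - {{}} \<noteq> {}"
    using assms by auto
  then obtain X where X: "X \<in> Pow A - {{}}" and Xmin: "\<And>Z. Z \<in> Pow A - {{}} \<Longrightarrow> q X \<le> q Z"
    using arg_min_if_finite[of "Pow A - {{}}" q] by (metis not_le)
  have "X \<subseteq> A" "X \<noteq> {}" "finite X" using X \<open>finite A\<close> finite_subset by auto
  have q0: "0 \<le> q X" by (simp add: q_def)
  have qK: "q X \<le> K"
  proof -
    have "q X \<le> q A" using assms by (intro Xmin) auto
    also have "\<dots> \<le> K"
      using assms by (simp add: q_def divide_le_eq card_gt_0_iff)
    finally show ?thesis .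
  qed
  have Zmin: "q X * card Z \<le> card (Z + B)" if "Z \<subseteq> X" for Z
  proof (cases "Z = {}")
    case False
    have "finite Z" using that \<open>finite X\<close> finite_subset by blast
    then have "0 < real (card Z)" using False by (simp add: card_gt_0_iff)
    moreover have "q X \<le> q Z" using False that \<open>X \<subseteq> A\<close> by (intro Xmin) auto
    ultimately show ?thesis by (simp add: q_def[of Z] pos_le_divide_eq)
  qed simp
  have Xeq: "card (X + B) = q X * card X"
    using \<open>finite X\<close> \<open>X \<noteq> {}\<close> by (simp add: q_def)
  have "card (X + (\<Sum>i<n. B)) \<le> K ^ n * card X" for n :: nat
  proof (induction n)
    case (Suc n)
    have "real (card (X + (\<Sum>i<Suc n. B))) = card (X + B + (\<Sum>i<n. B))"
      by (simp add: ac_simps)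
    also have "\<dots> \<le> q X * card (X + (\<Sum>i<n. B))"
      using \<open>finite X\<close> assms finite_sumset_const q0 Zmin Xeq
      by (intro card_plus_le_of_minimal_ratio) auto
    also have "\<dots> \<le> K * (K ^ n * card X)"
      using Suc qK q0 by (intro mult_mono) auto
    finally show ?case by simp
  qed simp
  then show thesis using that \<open>X \<subseteq> A\<close> \<open>X \<noteq> {}\<close> by blast
qed

text \<open>Fix one representation \<open>d = f d - g d\<close> of each difference. The map
  \<open>(x, d)\<close> to \<open>(x + f d, x + g d)\<close> is injective: subtracting the
  coordinates recovers \<open>d\<close>, and then \<open>x\<close>.\<close>

lemma Ruzsa_triangle:
  fixes X Y Z :: "'a::ab_group_add set"
  assumes "finite X" "finite Y" "finite Z"
  shows "card X * card (Y + uminus ` Z) \<le> card (X + Y) * card (X + Z)"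
proof -
  have "\<forall>d \<in> Y + uminus ` Z. \<exists>y z. y \<in> Y \<and> z \<in> Z \<and> d = y - z"
    by (force elim!: set_plus_elim)
  then obtain f g where fg: "\<And>d. d \<in> Y + uminus ` Z \<Longrightarrow> f d \<in> Y \<and> g d \<in> Z \<and> d = f d - g d"
    by metis
  define h where "h = (\<lambda>(x, d). (x + f d, x + g d))"
  have "inj_on h (X \<times> (Y + uminus ` Z))"
  proof (rule inj_onI, clarify)
    fix x d x' d'
    assume d: "d \<in> Y + uminus ` Z" "d' \<in> Y + uminus ` Z" and "h (x, d) = h (x', d')"
    then have eqs: "x + f d = x' + f d'" "x + g d = x' + g d'" by (auto simp: h_def)
    have "d = (x + f d) - (x + g d)" using fg d by simp
    also have "\<dots> = d'" unfolding eqs using fg d by simp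
    finally show "x = x' \<and> d = d'" using eqs by simp
  qed
  moreover have "h ` (X \<times> (Y + uminus ` Z)) \<subseteq> (X + Y) \<times> (X + Z)"
    using fg by (auto simp: h_def)
  ultimately have "card (X \<times> (Y + uminus ` Z)) \<le> card ((X + Y) \<times> (X + Z))"
    using assms by (intro card_inj_on_le) (auto simp: finite_set_plus)
  then show ?thesis by (simp add: card_cartesian_product)
qed

text \<open>The iterated sumset mA - nA. Negation is an image because minus on sets is set
  difference; empty sums give \<open>{0}\<close>.\<close>

definition signed_sumset :: "'a::ab_group_add set \<Rightarrow> nat \<Rightarrow> nat \<Rightarrow> 'a set" where
  "signed_sumset A m n = (\<Sum>i<m. A) + (\<Sum>i<n. uminus ` A)"

lemma uminus_image_plus: "uminus ` (A + B) = uminus ` A + uminus ` B"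
  for A B :: "'a::ab_group_add set"
proof -
  have "- (a + b) \<in> uminus ` A + uminus ` B" if "a \<in> A" "b \<in> B" for a b
    using set_plus_intro[of "- a" "uminus ` A" "- b" "uminus ` B"] that by simp
  moreover have "- a + - b \<in> uminus ` (A + B)" if "a \<in> A" "b \<in> B" for a b
    using that by (metis minus_add_distrib imageI set_plus_intro)
  ultimately show ?thesis by (auto elim!: set_plus_elim)
qed

lemma uminus_image_sumset_const: "uminus ` (\<Sum>i<n. A) = (\<Sum>i<n. uminus ` A)"
  for A :: "'a::ab_group_add set" and n :: nat
  by (induction n) (simp_all add: uminus_image_plus)

lemma sumset_const_add: "(\<Sum>i<m + n. A) = (\<Sum>i<m. A) + (\<Sum>i<n. A)"
  for A :: "'a::comm_monoid_add set" and m n :: nat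
  by (induction n) (simp_all add: ac_simps)

lemma signed_sumset_add:
  "signed_sumset A m n + signed_sumset A m' n' = signed_sumset A (m + m') (n + n')"
  by (simp add: signed_sumset_def sumset_const_add ac_simps)

lemma finite_signed_sumset: "finite A \<Longrightarrow> finite (signed_sumset A m n)"
  by (simp add: signed_sumset_def finite_set_plus finite_sumset_const)

lemma signed_sumset_uminus: "signed_sumset (uminus ` A) m n = signed_sumset A n m"
  by (simp add: signed_sumset_def image_image ac_simps)

text \<open>The triangle inequality with the common \<open>X\<close> from \<open>Pluennecke\<close>
  bounds \<open>card X\<close> times the left side by \<open>K ^ (m + n) * (card X)^2\<close>.
  Cancel \<open>card X\<close> and use \<open>X \<subseteq> A\<close>.\<close>

lemma Pluennecke_Ruzsa:
  fixes A B :: "'a::ab_group_add set" and K :: real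
  assumes "finite A" "A \<noteq> {}" "finite B" "card (A + B) \<le> K * card A"
  shows "card (signed_sumset B m n) \<le> K ^ (m + n) * card A"
proof -
  obtain X where X: "X \<subseteq> A" "X \<noteq> {}" "\<And>n. card (X + (\<Sum>i<n. B)) \<le> K ^ n * card X"
    using Pluennecke[OF assms] by blast
  have finX: "finite X" using X assms finite_subset by blast
  have K: "0 \<le> K"
  proof -
    have "0 \<le> K * real (card A)" using assms(4) by linarith
    moreover have "0 < real (card A)" using assms by (simp add: card_gt_0_iff)
    ultimately show ?thesis by (simp add: zero_le_mult_iff)
  qed
  have "real (card X) * card (signed_sumset B m n)
      \<le> card (X + (\<Sum>i<m. B)) * card (X + (\<Sum>i<n. B))"
    using Ruzsa_triangle[OF finX finite_sumset_const finite_sumset_const, of B B m n] assms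
    by (simp add: signed_sumset_def uminus_image_sumset_const flip: of_nat_mult)
  also have "\<dots> \<le> (K ^ m * card X) * (K ^ n * card X)"
    unfolding of_nat_mult using X K by (intro mult_mono) auto
  finally have "real (card X) * card (signed_sumset B m n)
      \<le> real (card X) * (K ^ (m + n) * card X)"
    by (simp add: power_add ac_simps)
  then have "card (signed_sumset B m n) \<le> K ^ (m + n) * card X"
    using X finX by (simp add: card_gt_0_iff)
  also have "\<dots> \<le> K ^ (m + n) * card A"
    using X assms K by (intro mult_left_mono) (auto intro: card_mono)
  finally show ?thesis .
qed

text \<open>Take a largest \<open>X \<subseteq> B\<close> for which the translates
  \<open>x + A\<close> are disjoint. Counting them inside \<open>B + A\<close> bounds
  \<open>card X\<close>; by maximality every \<open>b + A\<close> meets some \<open>x + A\<close>,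
  which puts \<open>b\<close> in \<open>x + A - A\<close>.\<close>

lemma Ruzsa_covering:
  fixes A B :: "'a::ab_group_add set"
  assumes "finite A" "A \<noteq> {}" "finite B"
  obtains X where "X \<subseteq> B" "card X * card A \<le> card (B + A)" "B \<subseteq> X + (A + uminus ` A)"
proof -
  \<comment> \<open>Injectivity of addition on \<open>X \<times> A\<close> says that the translates
    of \<open>A\<close> are pairwise disjoint.\<close>
  define P where "P = (\<lambda>X. X \<subseteq> B \<and> inj_on (\<lambda>(x, a). x + a) (X \<times> A))"
  have "P {}" by (simp add: P_def)
  moreover have "\<forall>X. P X \<longrightarrow> card X < Suc (card B)"
    using assms by (auto simp: P_def less_Suc_eq_le intro: card_mono)
  ultimately obtain X where PX: "P X" and Xmax: "\<And>Y. P Y \<Longrightarrow> card Y \<le> card X"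
    using ex_has_greatest_nat[of P "{}" card "Suc (card B)"] by (metis less_imp_le)
  have XB: "X \<subseteq> B" and inj: "inj_on (\<lambda>(x, a). x + a) (X \<times> A)" using PX by (auto simp: P_def)
  have finX: "finite X" using XB assms finite_subset by blast
  have "card (X \<times> A) \<le> card (B + A)"
    using inj XB assms by (intro card_inj_on_le[where f = "\<lambda>(x, a). x + a"]) (auto simp: finite_set_plus)
  moreover have "B \<subseteq> X + (A + uminus ` A)"
  proof
    fix b assume "b \<in> B"
    have repr: "b \<in> X + (A + uminus ` A)" if "x \<in> X" "a \<in> A" "a' \<in> A" "b + a' = x + a" for x a a'
    proof -
      have "b = x + (a + - a')" using that(4) by (simp add: algebra_simps eq_diff_eq)
      also have "\<dots> \<in> X + (A + uminus ` A)" using that by (intro set_plus_intro imageI)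
      finally show ?thesis .
    qed
    show "b \<in> X + (A + uminus ` A)"
    proof (cases "b \<in> X")
      case True
      then show ?thesis using \<open>A \<noteq> {}\<close> repr by blast
    next
      case False
      then have "\<not> P (insert b X)"
        using Xmax[of "insert b X"] finX by auto
      then obtain u a v a' where uv: "u \<in> insert b X" "v \<in> insert b X" "a \<in> A" "a' \<in> A"
          "u + a = v + a'" "(u, a) \<noteq> (v, a')"
        using XB \<open>b \<in> B\<close> unfolding P_def inj_on_def by auto
      \<comment> \<open>The collision must join \<open>b + A\<close> to a translate from
        \<open>X\<close>: two points of \<open>X\<close> contradict \<open>inj\<close>, and
        \<open>u = v\<close> would force \<open>a = a'\<close>.\<close>
      have "\<not> (u \<in> X \<and> v \<in> X)"
        using inj_onD[OF inj, of "(u, a)" "(v, a')"] uv by auto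
      moreover have "u \<noteq> v" using uv by auto
      ultimately consider "u = b" "v \<in> X" | "v = b" "u \<in> X" using uv by auto
      then show ?thesis
      proof cases
        case 1
        then show ?thesis using repr[of v a' a] uv by simp
      next
        case 2
        then show ?thesis using repr[of u a a'] uv by simp
      qed
    qed
  qed
  ultimately show thesis using that XB by (simp add: card_cartesian_product)
qed

section \<open>Sums of dilates\<close>

lemma elt_times_eq_image: "c *o A = (*) c ` A"
  by (auto simp: elt_set_times_def)

text \<open>Dilation by 1, -1 or 0 gives A, -A or \<open>{0}\<close> (the last because
  \<open>A\<close> is non-empty), so only non-zero digits contribute summands. Their number becomes
  the exponent of \<open>K\<close>.\<close>

lemma sumset_unit_dilates:
  fixes A :: "int set" and \<epsilon> :: "'i \<Rightarrow> int"
  assumes "finite I" "A \<noteq> {}" "\<And>i. i \<in> I \<Longrightarrow> \<bar>\<epsilon> i\<bar> \<le> 1"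
  shows "\<exists>m n. (\<Sum>i\<in>I. \<epsilon> i *o A) = signed_sumset A m n \<and> int (m + n) = (\<Sum>i\<in>I. \<bar>\<epsilon> i\<bar>)"
  using assms(1,3)
proof (induction I)
  case empty
  then show ?case by (intro exI[of _ 0]) (simp add: signed_sumset_def)
next
  case (insert j I)
  then obtain m n where mn: "(\<Sum>i\<in>I. \<epsilon> i *o A) = signed_sumset A m n"
      "int (m + n) = (\<Sum>i\<in>I. \<bar>\<epsilon> i\<bar>)"
    by auto
  have "\<exists>m' n'. \<epsilon> j *o A = signed_sumset A m' n' \<and> int (m' + n') = \<bar>\<epsilon> j\<bar>"
  proof -
    have "\<bar>\<epsilon> j\<bar> \<le> 1" using insert.prems by simp
    then consider "\<epsilon> j = 0" | "\<epsilon> j = 1" | "\<epsilon> j = -1" by linarith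
    then show ?thesis
    proof cases
      case 1
      then show ?thesis using \<open>A \<noteq> {}\<close>
        by (intro exI[of _ 0]) (auto simp: signed_sumset_def elt_times_eq_image)
    next
      case 2
      then show ?thesis by (intro exI[of _ 1] exI[of _ 0]) (simp add: signed_sumset_def)
    next
      case 3
      then show ?thesis
        by (intro exI[of _ 0] exI[of _ 1]) (simp add: signed_sumset_def elt_times_eq_image)
    qed
  qed
  then obtain m' n' where "\<epsilon> j *o A = signed_sumset A m' n'" "int (m' + n') = \<bar>\<epsilon> j\<bar>"
    by blast
  then show ?case using mn insert.hyps
    by (intro exI[of _ "m' + m"] exI[of _ "n' + n"]) (simp add: signed_sumset_add)
qed

text \<open>Only an inclusion, since the right side lets the two summands come from different
  elements of \<open>A\<close>.\<close>

lemma dilate_add_subset: "(a + c * b) *o A \<subseteq> a *o A + c *o (b *o A)"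
  for a b c :: "'a::comm_semiring"
  by (force simp: elt_times_eq_image distrib_right mult.assoc)

lemma sumset_mono: "(\<And>i. i \<in> I \<Longrightarrow> F i \<subseteq> G i) \<Longrightarrow> (\<Sum>i\<in>I. F i) \<subseteq> (\<Sum>i\<in>I. G i)"
  for F G :: "'i \<Rightarrow> 'a::comm_monoid_add set"
  by (induction I rule: infinite_finite_induct) (simp_all add: set_plus_mono2)

lemma dilate_sumset: "c *o (\<Sum>i\<in>I. F i) = (\<Sum>i\<in>I. c *o F i)"
  for F :: "'i \<Rightarrow> 'a::comm_ring_1 set"
  by (induction I rule: infinite_finite_induct)
    (simp_all add: set_times_plus_distrib2 elt_times_eq_image[of _ "{0}"])

section \<open>Covering sums of dilates one binary digit at a time\<close>

lemma card_plus_le: "finite X \<Longrightarrow> finite Y \<Longrightarrow> card (X + Y) \<le> card X * card Y"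
  using card_image_le[of "X \<times> Y" "\<lambda>(x, y). x + y"]
  by (simp add: set_plus_image card_cartesian_product)

text \<open>Halving an odd \<open>\<bar>l\<bar> = 1 + 2 * m\<close> lowers the logarithm by exactly
  1, as \<open>1 + \<bar>l\<bar> = 2 * (1 + m)\<close>; this pays for the digit. For even
  \<open>\<bar>l\<bar>\<close> there is no digit to pay for.\<close>

lemma log_one_plus_abs_binary:
  fixes l :: int
  shows "real_of_int (\<bar>l\<bar> mod 2) + log 2 (1 + real_of_int (\<bar>l\<bar> div 2)) \<le> log 2 (1 + real_of_int \<bar>l\<bar>)"
proof -
  define e where "e = \<bar>l\<bar> mod 2"
  define m where "m = \<bar>l\<bar> div 2"
  have l: "\<bar>l\<bar> = e + 2 * m" and "0 \<le> m" by (simp_all add: e_def m_def)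
  have "e = 0 \<or> e = 1" unfolding e_def by presburger
  then have "real_of_int e + log 2 (1 + real_of_int m) \<le> log 2 (1 + real_of_int (e + 2 * m))"
  proof
    assume "e = 0"
    then show ?thesis using \<open>0 \<le> m\<close> by simp
  next
    assume "e = 1"
    have "log 2 (2 * (1 + real_of_int m)) = log 2 2 + log 2 (1 + real_of_int m)"
      using \<open>0 \<le> m\<close> by (intro log_mult_pos) auto
    then show ?thesis using \<open>e = 1\<close> by (simp add: distrib_left)
  qed
  then show ?thesis unfolding l[symmetric] unfolding e_def m_def .
qed

text \<open>Induction on the number \<open>r\<close> of binary places, removing the lowest digit. A
  covering, unlike a cardinality bound, survives doubling: the centres become \<open>2 *o X\<close>,
  and the doubled \<open>A - A\<close> joins the digit part to be covered again.\<close>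

lemma sumset_dilates_covering:
  fixes A :: "int set" and K :: real and l :: "'i \<Rightarrow> int"
  assumes A: "finite A" "A \<noteq> {}" and "finite I" and "1 \<le> K"
    and PR: "\<And>m n. card (signed_sumset A m n) \<le> K ^ (m + n) * card A"
    and "\<And>i. i \<in> I \<Longrightarrow> \<bar>l i\<bar> < 2 ^ r"
  shows "\<exists>X. finite X \<and> (\<Sum>i\<in>I. l i *o A) \<subseteq> X + (A + uminus ` A) \<and>
    card X \<le> K powr ((\<Sum>i\<in>I. log 2 (1 + real_of_int \<bar>l i\<bar>)) + 5 * real r)"
  using assms(6)
proof (induction r arbitrary: l)
  case 0
  then have zero: "(\<Sum>i\<in>I. l i *o A) = 0"
    using A by (intro sum.neutral) (auto simp: elt_times_eq_image)
  have "0 \<in> A + uminus ` A"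
    using A set_plus_intro by (metis add.right_inverse ex_in_conv imageI)
  then show ?case unfolding zero using 0 \<open>1 \<le> K\<close> by (intro exI[of _ "{0}"]) simp
next
  case (Suc r)
  \<comment> \<open>Digits are taken from the absolute value and the sign is restored afterwards.
    Plain \<open>div\<close> rounds downwards, so \<open>-1\<close> would never reach 0.\<close>
  define e where "e = (\<lambda>i. sgn (l i) * (\<bar>l i\<bar> mod 2))"
  define u where "u = (\<lambda>i. sgn (l i) * (\<bar>l i\<bar> div 2))"
  have l: "l i = e i + 2 * u i" for i
  proof -
    have "e i + 2 * u i = sgn (l i) * (\<bar>l i\<bar> mod 2 + 2 * (\<bar>l i\<bar> div 2))"
      by (simp only: e_def u_def distrib_left mult.left_commute)
    also have "\<dots> = l i" by (simp add: sgn_mult_abs)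
    finally show ?thesis ..
  qed
  have abs_e: "\<bar>e i\<bar> = \<bar>l i\<bar> mod 2" and abs_u: "\<bar>u i\<bar> = \<bar>l i\<bar> div 2" for i
    by (auto simp: e_def u_def abs_mult sgn_if)
  have "\<bar>u i\<bar> < 2 ^ r" if "i \<in> I" for i
    using Suc.prems[OF that] by (simp add: abs_u)
  from Suc.IH[of u, OF this] obtain X where X: "finite X"
      "(\<Sum>i\<in>I. u i *o A) \<subseteq> X + (A + uminus ` A)"
      "card X \<le> K powr ((\<Sum>i\<in>I. log 2 (1 + real_of_int \<bar>u i\<bar>)) + 5 * real r)"
    by auto
  have "\<bar>e i\<bar> \<le> 1" for i unfolding abs_e by presburger
  then obtain m n where mn: "(\<Sum>i\<in>I. e i *o A) = signed_sumset A m n"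
      "int (m + n) = (\<Sum>i\<in>I. \<bar>e i\<bar>)"
    using sumset_unit_dilates[OF \<open>finite I\<close> A(2), of e] by blast
  define B where "B = signed_sumset A m n + (2 *o A + 2 *o (uminus ` A))"
  have finB: "finite B"
    using A by (simp add: B_def finite_set_plus finite_signed_sumset elt_times_eq_image)
  obtain Y where Y: "Y \<subseteq> B" "card Y * card A \<le> card (B + A)" "B \<subseteq> Y + (A + uminus ` A)"
    using Ruzsa_covering[OF A finB] by blast
  have finY: "finite Y" using Y finB finite_subset by blast
  have double: "2 *o C \<subseteq> C + C" for C :: "int set"
    unfolding elt_times_eq_image mult_2 by (intro image_subsetI set_plus_intro)
  \<comment> \<open>The 5 extra summands: two copies each of A and -A contain the dilates in
    \<open>B\<close>, and one more A comes from the covering lemma.\<close>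
  have "B + A \<subseteq> signed_sumset A m n + ((A + A) + (uminus ` A + uminus ` A)) + A"
    unfolding B_def by (intro set_plus_mono2 double order.refl)
  also have "\<dots> = signed_sumset A m n + signed_sumset A 3 2"
    by (simp add: signed_sumset_def numeral_eq_Suc ac_simps)
  also have "\<dots> = signed_sumset A (m + 3) (n + 2)"
    by (rule signed_sumset_add)
  finally have BA: "B + A \<subseteq> signed_sumset A (m + 3) (n + 2)" .
  have "real (card Y) * card A \<le> card (signed_sumset A (m + 3) (n + 2))"
    using Y(2) card_mono[OF finite_signed_sumset[OF A(1)] BA]
    by (simp flip: of_nat_mult)
  also have "\<dots> \<le> K ^ (m + n + 5) * card A"
    using PR[of "m + 3" "n + 2"] by (simp add: ac_simps)
  finally have "card Y \<le> K ^ (m + n + 5)"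
    using A by (simp add: card_gt_0_iff)
  also have "\<dots> = K powr ((\<Sum>i\<in>I. real_of_int \<bar>e i\<bar>) + 5)"
  proof -
    have "real (m + n + 5) = real_of_int (int (m + n)) + 5" by simp
    also have "\<dots> = (\<Sum>i\<in>I. real_of_int \<bar>e i\<bar>) + 5" unfolding mn(2) by simp
    finally show ?thesis using \<open>1 \<le> K\<close> powr_realpow[of K "m + n + 5"] by simp
  qed
  finally have cardY: "card Y \<le> K powr ((\<Sum>i\<in>I. real_of_int \<bar>e i\<bar>) + 5)" .
  \<comment> \<open>Split off the lowest digits, insert the cover for the halved coefficients,
    regroup everything except \<open>2 *o X\<close> into \<open>B\<close>, and cover
    \<open>B\<close>.\<close>
  have "(\<Sum>i\<in>I. l i *o A) \<subseteq> (\<Sum>i\<in>I. e i *o A + 2 *o (u i *o A))"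
    unfolding l by (intro sumset_mono dilate_add_subset)
  also have "\<dots> = signed_sumset A m n + 2 *o (\<Sum>i\<in>I. u i *o A)"
    by (simp add: sum.distrib dilate_sumset mn(1))
  also have "\<dots> \<subseteq> signed_sumset A m n + 2 *o (X + (A + uminus ` A))"
    using X(2) by (intro set_plus_mono2 set_times_mono order.refl)
  also have "\<dots> = 2 *o X + B"
    by (simp add: B_def set_times_plus_distrib2 ac_simps)
  also have "\<dots> \<subseteq> 2 *o X + (Y + (A + uminus ` A))"
    using Y(3) by (intro set_plus_mono2 order.refl)
  finally have sub: "(\<Sum>i\<in>I. l i *o A) \<subseteq> (2 *o X + Y) + (A + uminus ` A)"
    by (simp add: ac_simps)
  have fin2X: "finite (2 *o X)" using X by (simp add: elt_times_eq_image)
  have "card (2 *o X + Y) \<le> card (2 *o X) * card Y"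
    using fin2X finY by (rule card_plus_le)
  also have "\<dots> \<le> card X * card Y"
    using X(1) by (intro mult_right_mono) (auto simp: elt_times_eq_image card_image_le)
  finally have "real (card (2 *o X + Y)) \<le> real (card X) * card Y"
    by (simp flip: of_nat_mult)
  also have "\<dots> \<le> K powr ((\<Sum>i\<in>I. log 2 (1 + real_of_int \<bar>u i\<bar>)) + 5 * real r)
      * K powr ((\<Sum>i\<in>I. real_of_int \<bar>e i\<bar>) + 5)"
    using X(3) cardY by (intro mult_mono) auto
  also have "\<dots> = K powr ((\<Sum>i\<in>I. real_of_int \<bar>e i\<bar> + log 2 (1 + real_of_int \<bar>u i\<bar>)) + 5 * real (Suc r))"
    by (simp add: sum.distrib algebra_simps flip: powr_add)
  also have "\<dots> \<le> K powr ((\<Sum>i\<in>I. log 2 (1 + real_of_int \<bar>l i\<bar>)) + 5 * real (Suc r))"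
    unfolding abs_e abs_u using \<open>1 \<le> K\<close>
    by (intro powr_mono add_right_mono sum_mono log_one_plus_abs_binary)
  finally show ?case
    using sub fin2X finY by (intro exI[of _ "2 *o X + Y"]) (simp add: finite_set_plus)
qed

text \<open>Take \<open>r\<close> least. If \<open>r = Suc s\<close>, some
  \<open>\<bar>l i\<bar>\<close> is at least \<open>2 ^ s\<close>, so its logarithm alone is at
  least \<open>s\<close>.\<close>

lemma binary_length_le_sum_log:
  fixes l :: "'i \<Rightarrow> int"
  assumes "finite I"
  obtains r :: nat where "\<And>i. i \<in> I \<Longrightarrow> \<bar>l i\<bar> < 2 ^ r"
    "r \<le> 1 + (\<Sum>i\<in>I. log 2 (1 + real_of_int \<bar>l i\<bar>))"
proof -
  define P where "P r \<longleftrightarrow> (\<forall>i\<in>I. \<bar>l i\<bar> < 2 ^ r)" for r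
  \<comment> \<open>A crude witness suffices for existence: the sum \<open>S\<close> of the absolute
    values satisfies \<open>S < 2 ^ S\<close>.\<close>
  have "P (nat (\<Sum>i\<in>I. \<bar>l i\<bar>))"
    unfolding P_def
  proof
    fix i assume "i \<in> I"
    then have "\<bar>l i\<bar> \<le> (\<Sum>i\<in>I. \<bar>l i\<bar>)" using assms by (intro member_le_sum) auto
    also have "\<dots> = int (nat (\<Sum>i\<in>I. \<bar>l i\<bar>))" by (simp add: sum_nonneg)
    also have "\<dots> < 2 ^ nat (\<Sum>i\<in>I. \<bar>l i\<bar>)" by (rule of_nat_less_two_power)
    finally show "\<bar>l i\<bar> < 2 ^ nat (\<Sum>i\<in>I. \<bar>l i\<bar>)" .
  qed
  then have least: "P (LEAST r. P r)" by (rule LeastI)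
  have nonneg: "0 \<le> log 2 (1 + real_of_int \<bar>l i\<bar>)" for i by simp
  have "real (LEAST r. P r) \<le> 1 + (\<Sum>i\<in>I. log 2 (1 + real_of_int \<bar>l i\<bar>))"
  proof (cases "LEAST r. P r")
    case 0
    then show ?thesis using nonneg by (simp add: sum_nonneg)
  next
    case (Suc s)
    then have "\<not> P s" by (metis not_less_Least lessI)
    then obtain i where i: "i \<in> I" "2 ^ s \<le> \<bar>l i\<bar>" by (auto simp: P_def not_less)
    then have "real_of_int (2 ^ s) \<le> real_of_int \<bar>l i\<bar>" by (simp only: of_int_le_iff)
    then have "2 powr real s \<le> 1 + real_of_int \<bar>l i\<bar>" by (simp add: powr_realpow)
    then have "real s \<le> log 2 (1 + real_of_int \<bar>l i\<bar>)" by (subst le_log_iff) auto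
    also have "\<dots> \<le> (\<Sum>i\<in>I. log 2 (1 + real_of_int \<bar>l i\<bar>))"
      using i assms nonneg by (intro member_le_sum) auto
    finally show ?thesis using Suc by simp
  qed
  then show thesis using that least by (auto simp: P_def)
qed

section \<open>From the covering to the stated exponent\<close>

lemma difference_set_eq: "difference_set A B = A + uminus ` B"
  by (force simp: difference_set_def set_plus_def)

theorem theorem3:
  fixes A :: "int set" and K p :: real and k :: nat and lam :: "nat \<Rightarrow> int"
  assumes "finite A" and "A \<noteq> {}" and "k \<ge> 1"
    and "real (card (A + A)) \<le> K * real (card A) \<or>
         real (card (difference_set A A)) \<le> K * real (card A)"
    and "p = 7 + 12 * (\<Sum>i=1..k. log 2 (1 + real_of_int \<bar>lam i\<bar>))"
  shows "real (card (\<Sum>i=1..k. lam i *o A)) \<le> K powr p * real (card A)"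
proof -
  define L where "L = (\<Sum>i=1..k. log 2 (1 + real_of_int \<bar>lam i\<bar>))"
  have "0 \<le> L" unfolding L_def by (intro sum_nonneg) simp
  have A0: "0 < card A" using assms by (simp add: card_gt_0_iff)
  have finU: "finite (uminus ` A)" using assms by simp
  \<comment> \<open>Both alternatives take the form \<open>card (A + B) \<le> K * card A\<close>,
    with \<open>B\<close> equal to A or -A.\<close>
  from assms(4) obtain B where B: "B = A \<or> B = uminus ` A" "card (A + B) \<le> K * card A"
    unfolding difference_set_eq by blast
  then have finB: "finite B" using assms by auto
  \<comment> \<open>\<open>A + B\<close> contains a translate of \<open>A\<close>. The bound makes
    powers of \<open>K\<close> monotone in the exponent.\<close>
  have "1 \<le> K"
  proof -
    obtain b where b: "b \<in> B" using B assms by auto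
    have "card A = card (A + {b})" by (simp add: card_plus_sing)
    also have "\<dots> \<le> card (A + B)"
      using b assms(1) finB by (intro card_mono finite_set_plus set_plus_mono2) simp_all
    finally have "real (card A) \<le> K * card A" using B by linarith
    then show ?thesis using A0 by simp
  qed
  have PR: "card (signed_sumset A m n) \<le> K ^ (m + n) * card A" for m n
    using B(1)
  proof
    assume "B = A"
    then show ?thesis using Pluennecke_Ruzsa[OF assms(1,2) finB B(2)] by simp
  next
    \<comment> \<open>Negating the set swaps \<open>m\<close> and \<open>n\<close>, which leaves the
      exponent \<open>m + n\<close> unchanged.\<close>
    assume "B = uminus ` A"
    then show ?thesis using Pluennecke_Ruzsa[OF assms(1,2) finB B(2), of n m]
      by (simp add: signed_sumset_uminus add.commute)
  qed
  obtain r :: nat where r: "\<And>i. i \<in> {1..k} \<Longrightarrow> \<bar>lam i\<bar> < 2 ^ r" "r \<le> 1 + L"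
    using binary_length_le_sum_log[of "{1..k}" lam] unfolding L_def by blast
  have "\<exists>X. finite X \<and> (\<Sum>i=1..k. lam i *o A) \<subseteq> X + (A + uminus ` A) \<and>
      card X \<le> K powr (L + 5 * real r)"
    unfolding L_def
    by (rule sumset_dilates_covering[OF assms(1,2) finite_atLeastAtMost \<open>1 \<le> K\<close> PR r(1)])
  then obtain X where X: "finite X" "(\<Sum>i=1..k. lam i *o A) \<subseteq> X + (A + uminus ` A)"
      "card X \<le> K powr (L + 5 * real r)"
    by blast
  have finD: "finite (A + uminus ` A)" using assms finU by (simp add: finite_set_plus)
  have D: "card (A + uminus ` A) \<le> K powr 2 * card A"
    using PR[of 1 1] \<open>1 \<le> K\<close> by (simp add: signed_sumset_def power2_eq_square)
  have "card (\<Sum>i=1..k. lam i *o A) \<le> card (X + (A + uminus ` A))"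
    using X finD by (intro card_mono) (auto simp: finite_set_plus)
  also have "\<dots> \<le> card X * card (A + uminus ` A)"
    using X(1) finD by (rule card_plus_le)
  finally have "real (card (\<Sum>i=1..k. lam i *o A)) \<le> real (card X) * card (A + uminus ` A)"
    by (simp flip: of_nat_mult)
  also have "\<dots> \<le> K powr (L + 5 * real r) * (K powr 2 * card A)"
    using X(3) D by (intro mult_mono) auto
  also have "\<dots> = K powr (L + 5 * real r + 2) * card A"
    by (simp add: powr_add)
  \<comment> \<open>Since \<open>r \<le> 1 + L\<close>, the exponent \<open>L + 5 * r + 2\<close> is
    at most \<open>7 + 6 * L\<close>, hence at most \<open>p\<close> because \<open>L\<close> is
    non-negative.\<close>
  also have "\<dots> \<le> K powr p * card A"
    using \<open>1 \<le> K\<close> \<open>0 \<le> L\<close> r(2) assms(5) unfolding L_def[symmetric]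
    by (intro mult_right_mono powr_mono) auto
  finally show ?thesis .
qed

end
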